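(* Let $\boldsymbol{p}=[-1,1]^K$, let $A^{(0)},\dots,A^{(K)}\in\mathbb{R}^{n\times n}$, let $A(p)=A^{(0)}+\sum_{k=1}^K A^{(k)}p_k$ for $p\in\mathbb{R}^K$, and suppose that the (normalised) parametric interval matrix $A(\boldsymbol{p})$ is symmetric, i.e. $A(p)$ is a symmetric matrix for every $p\in\boldsymbol{p}$. Suppose that $A(p^c)$ is stable, where $p^c=0$ is the midpoint of $\boldsymbol{p}$. Then the radius of stability and the radius of regularity of $A(\boldsymbol{p})$ coincide: $$s(A(\boldsymbol{p}))=r(A(\boldsymbol{p})).$$
   Context: A parametric interval matrix with affine-linear dependencies is a family $A(\boldsymbol{p})=\{A(p)=A^{(0)}+\sum_{k=1}^K A^{(k)}p_k \mid p\in\boldsymbol{p}\}$ of real $n\times n$ matrices, where $\boldsymbol{p}$ is a product of compact intervals; it is normalised when every parameter ranges over $[-1,1]$, so that the midpoint is $p^c=0$ and the radius is $p^\Delta=(1,\dots,1)$. A real square matrix is stable (Hurwitz) if every eigenvalue has strictly negative real part, and unstable otherwise. The radius of regularity is $$r(A(\boldsymbol{p}))=\min\{r\ge 0\mid \exists\, p\in\boldsymbol{p}:\ A(rp)\text{ is singular}\},$$ and the radius of stability is $$s(A(\boldsymbol{p}))=\min\{r\ge 0\mid \exists\, p\in p^c+r[-p^\Delta,p^\Delta]:\ A(p)\text{ is unstable}\},$$ where $p^c+r[-p^\Delta,p^\Delta]$ is the box of vectors $p$ with $|p_k-p^c_k|\le r p^\Delta_k$ for all $k$. The minimum of an empty set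 is taken to be $+\infty$. *)

theory Defs
  imports "HOL-Analysis.Analysis"
begin

text \<open>A parameter vector with \<open>K\<close> real entries is a function \<open>p\<close> on \<open>nat\<close> of which only the
  entries \<open>p 1, \<dots>, p K\<close> matter. The remaining entries are unconstrained, and no definition below
  depends on them.\<close>

definition par_matrix :: "nat \<Rightarrow> (nat \<Rightarrow> real ^ 'n ^ 'n) \<Rightarrow> (nat \<Rightarrow> real) \<Rightarrow> real ^ 'n ^ 'n" where
  "par_matrix K A p = A 0 + (\<Sum>k = 1..K. p k *\<^sub>R A k)"

definition param_box :: "nat \<Rightarrow> (nat \<Rightarrow> real) \<Rightarrow> (nat \<Rightarrow> real) \<Rightarrow> (nat \<Rightarrow> real) set" where
  "param_box K lo hi = {p. \<forall>k\<in>{1..K}. lo k \<le> p k \<and> p k \<le> hi k}"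

definition param_mid :: "(nat \<Rightarrow> real) \<Rightarrow> (nat \<Rightarrow> real) \<Rightarrow> nat \<Rightarrow> real" where
  "param_mid lo hi k = (lo k + hi k) / 2"

definition param_rad :: "(nat \<Rightarrow> real) \<Rightarrow> (nat \<Rightarrow> real) \<Rightarrow> nat \<Rightarrow> real" where
  "param_rad lo hi k = (hi k - lo k) / 2"

text \<open>The eigenvalues of a real matrix are its complex ones, with complex eigenvectors.\<close>

definition eigenvalue :: "real ^ 'n ^ 'n \<Rightarrow> complex \<Rightarrow> bool" where
  "eigenvalue M z \<longleftrightarrow> (\<exists>v. v \<noteq> 0 \<and> map_matrix complex_of_real M *v v = z *s v)"

definition hurwitz_stable :: "real ^ 'n ^ 'n \<Rightarrow> bool" where
  "hurwitz_stable M \<longleftrightarrow> (\<forall>z. eigenvalue M z \<longrightarrow> Re z < 0)"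

text \<open>For the sets used below, a nonempty set has a least element (by compactness of the boxes and
  closedness of the singular and of the unstable matrices), so \<open>LEAST\<close> is a true minimum.\<close>

definition min_or_infinity :: "real set \<Rightarrow> ereal" where
  "min_or_infinity S = (if S = {} then \<infinity> else ereal (LEAST r. r \<in> S))"

text \<open>Scaling \<open>p\<close> by \<open>r\<close> in the regularity radius scales the box about the origin; this is
  the form for a normalised parametric matrix, whose midpoint is \<open>0\<close>.\<close>

definition regularity_radius ::
    "nat \<Rightarrow> (nat \<Rightarrow> real ^ 'n ^ 'n) \<Rightarrow> (nat \<Rightarrow> real) \<Rightarrow> (nat \<Rightarrow> real) \<Rightarrow> ereal" where
  "regularity_radius K A lo hi = min_or_infinity
    {r. 0 \<le> r \<and> (\<exists>p \<in> param_box K lo hi. \<not> invertible (par_matrix K A (\<lambda>k. r * p k)))}"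

definition stability_radius ::
    "nat \<Rightarrow> (nat \<Rightarrow> real ^ 'n ^ 'n) \<Rightarrow> (nat \<Rightarrow> real) \<Rightarrow> (nat \<Rightarrow> real) \<Rightarrow> ereal" where
  "stability_radius K A lo hi = min_or_infinity
    {r. 0 \<le> r \<and> (\<exists>p. (\<forall>k\<in>{1..K}. \<bar>p k - param_mid lo hi k\<bar> \<le> r * param_rad lo hi k)
                      \<and> \<not> hurwitz_stable (par_matrix K A p))}"

end

theory Submission
  imports Defs
begin

text \<open>
  Both radii are minima of sets of numbers \<open>r\<close>, and these two sets are equal. A singular matrix has
  the eigenvalue \<open>0\<close>, so it is unstable. Conversely, let \<open>A(p)\<close> be unstable, with \<open>p\<close> in
  the box of radius \<open>r\<close>. The segment from \<open>A(0)\<close> to \<open>A(p)\<close> consists of the matrices \<open>A(t p)\<close>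
  for \<open>0 \<le> t \<le> 1\<close>, whose parameters stay in that box, so it suffices that one of them is singular.
  The eigenvalues of symmetric matrices are real and move continuously, hence one of them has to
  pass through \<open>0\<close> on the way.

  This crossing can be found without continuity of eigenvalues. Write \<open>M = A(0)\<close> and
  \<open>B = A(p) - A(0)\<close>. A stable symmetric matrix is negative definite, so the quotient of the
  quadratic forms of \<open>B\<close> and \<open>- M\<close> is continuous on the unit sphere and attains a maximum \<open>m\<close>
  there. Instability of \<open>M + B\<close> makes its quadratic form nonnegative somewhere, which forces
  \<open>m \<ge> 1\<close>. A maximiser \<open>v\<close> solves \<open>B v = - m M v\<close>, so the point \<open>M + (1/m) B\<close> of the segment is
  singular. The lemma \<open>generalised_rayleigh_maximum\<close> provides such a \<open>v\<close>; taken with the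
  identity in place of \<open>- M\<close>, it also yields that stable symmetric matrices are negative definite
  (\<open>stable_symmetric_imp_negative_definite\<close>).
\<close>

section \<open>Quadratic forms of symmetric matrices\<close>

lemma symmetric_inner_mult:
  fixes N :: "real ^ 'n ^ 'n"
  assumes "transpose N = N"
  shows "x \<bullet> (N *v y) = y \<bullet> (N *v x)"
  by (metis assms dot_lmul_matrix inner_commute transpose_matrix_vector)

lemma quadratic_form_scaleR:
  fixes N :: "real ^ 'n ^ 'n"
  shows "(c *\<^sub>R w) \<bullet> (N *v (c *\<^sub>R w)) = c\<^sup>2 * (w \<bullet> (N *v w))"
  by (simp add: matrix_vector_mult_scaleR power2_eq_square)

text \<open>A zero of a semidefinite form is an extremum of it, so the gradient \<open>2 N v\<close> vanishes
  there.\<close>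

lemma negative_semidefinite_kernel:
  fixes N :: "real ^ 'n ^ 'n"
  assumes sym: "transpose N = N"
    and nonpos: "\<And>w. w \<bullet> (N *v w) \<le> 0"
    and zero: "v \<bullet> (N *v v) = 0"
  shows "N *v v = 0"
proof (rule ccontr)
  assume "N *v v \<noteq> 0"
  define w where "w = N *v v"
  define c where "c = w \<bullet> (N *v w)"
  define s where "s = (w \<bullet> w) / (\<bar>c\<bar> + 1)"
  have pos: "w \<bullet> w > 0"
    using \<open>N *v v \<noteq> 0\<close> by (simp add: w_def)
  then have "s > 0"
    by (simp add: s_def)
  have "(v + s *\<^sub>R w) \<bullet> (N *v (v + s *\<^sub>R w)) = 2 * s * (w \<bullet> w) + s\<^sup>2 * c"
    using zero symmetric_inner_mult[OF sym, of v w]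
    by (simp add: matrix_vector_right_distrib matrix_vector_mult_scaleR inner_add_left inner_add_right
        c_def power2_eq_square algebra_simps flip: w_def)
  then have "s * (2 * (w \<bullet> w) + s * c) \<le> 0"
    using nonpos[of "v + s *\<^sub>R w"] by (simp add: power2_eq_square algebra_simps)
  then have "2 * (w \<bullet> w) \<le> - (s * c)"
    using \<open>s > 0\<close> by (simp add: mult_le_0_iff)
  also have "\<dots> = s * (- c)"
    by simp
  also have "\<dots> \<le> s * (\<bar>c\<bar> + 1)"
    using \<open>s > 0\<close> by (intro mult_left_mono) auto
  also have "\<dots> = w \<bullet> w"
    by (simp add: s_def)
  finally show False
    using pos by simp
qed

text \<open>The quotient of the two forms is invariant under scaling, so it has a maximum \<open>m\<close>, attained on
  the compact unit sphere. The form of \<open>N - m P\<close> is then nonpositive and vanishes at the maximiser,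
  which therefore lies in its kernel.\<close>

lemma generalised_rayleigh_maximum:
  fixes N P :: "real ^ 'n ^ 'n"
  assumes symN: "transpose N = N" and symP: "transpose P = P"
    and posP: "\<And>w. w \<noteq> 0 \<Longrightarrow> w \<bullet> (P *v w) > 0"
  obtains m v where "v \<noteq> 0" "N *v v = m *\<^sub>R (P *v v)"
    "\<And>w. w \<bullet> (N *v w) \<le> m * (w \<bullet> (P *v w))"
proof -
  let ?S = "sphere (0 :: real ^ 'n) 1"
  let ?q = "\<lambda>w. (w \<bullet> (N *v w)) / (w \<bullet> (P *v w))"
  have ne: "w \<noteq> 0" if "w \<in> ?S" for w
    using that by auto
  have nz: "w \<bullet> (P *v w) \<noteq> 0" if "w \<in> ?S" for w
    using posP[OF ne[OF that]] by simp
  have "continuous_on ?S ?q"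
    by (intro continuous_intros matrix_vector_mult_linear_continuous_on) (use nz in auto)
  moreover have "?S \<noteq> {}"
    by simp
  ultimately obtain v where v: "v \<in> ?S" and max: "\<And>w. w \<in> ?S \<Longrightarrow> ?q w \<le> ?q v"
    using continuous_attains_sup[OF compact_sphere, of 0 1 ?q] by blast
  define m where "m = ?q v"
  have bound: "w \<bullet> (N *v w) \<le> m * (w \<bullet> (P *v w))" for w
  proof (cases "w = 0")
    case False
    define u where "u = (1 / norm w) *\<^sub>R w"
    have "u \<in> ?S"
      using False by (simp add: u_def)
    then have "u \<bullet> (N *v u) \<le> m * (u \<bullet> (P *v u))"
      using max[of u] posP[OF ne, of u] by (simp add: m_def pos_divide_le_eq)
    then have "(norm w)\<^sup>2 * (u \<bullet> (N *v u)) \<le> (norm w)\<^sup>2 * (m * (u \<bullet> (P *v u)))"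
      by (rule mult_left_mono) simp
    moreover have "w = norm w *\<^sub>R u"
      using False by (simp add: u_def)
    ultimately show ?thesis
      using quadratic_form_scaleR[of "norm w" u N] quadratic_form_scaleR[of "norm w" u P]
      by (simp add: mult.left_commute)
  qed simp
  have "(N - m *\<^sub>R P) *v v = 0"
  proof (rule negative_semidefinite_kernel)
    show "transpose (N - m *\<^sub>R P) = N - m *\<^sub>R P"
      using symN symP by (simp add: transpose_def vec_eq_iff)
    show "w \<bullet> ((N - m *\<^sub>R P) *v w) \<le> 0" for w
      using bound[of w]
      by (simp add: matrix_vector_mult_diff_rdistrib scaleR_matrix_vector_assoc[symmetric] inner_diff_right)
    show "v \<bullet> ((N - m *\<^sub>R P) *v v) = 0"
      using nz[OF v]
      by (simp add: matrix_vector_mult_diff_rdistrib scaleR_matrix_vector_assoc[symmetric] inner_diff_right m_def)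
  qed
  then have "N *v v = m *\<^sub>R (P *v v)"
    by (simp add: matrix_vector_mult_diff_rdistrib scaleR_matrix_vector_assoc[symmetric])
  with that bound ne[OF v] show ?thesis
    by blast
qed

section \<open>Stability and definiteness\<close>

lemma real_eigenvector_imp_eigenvalue:
  fixes M :: "real ^ 'n ^ 'n"
  assumes "v \<noteq> 0" "M *v v = m *\<^sub>R v"
  shows "eigenvalue M (complex_of_real m)"
  unfolding eigenvalue_def
proof (intro exI conjI)
  let ?v = "\<chi> i. complex_of_real (v $ i)"
  show "?v \<noteq> 0"
    using assms(1) by (simp add: vec_eq_iff)
  have "(\<Sum>j\<in>UNIV. M $ i $ j * v $ j) = m * v $ i" for i
    using assms(2) by (simp add: vec_eq_iff matrix_vector_mult_def)
  then have "(\<Sum>j\<in>UNIV. complex_of_real (M $ i $ j) * complex_of_real (v $ j))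
      = complex_of_real m * complex_of_real (v $ i)" for i
    by (simp flip: of_real_mult of_real_sum)
  then show "map_matrix complex_of_real M *v ?v = complex_of_real m *s ?v"
    by (simp add: vec_eq_iff matrix_vector_mult_def map_matrix_def)
qed

lemma singular_imp_unstable:
  fixes M :: "real ^ 'n ^ 'n"
  assumes "\<not> invertible M"
  shows "\<not> hurwitz_stable M"
proof -
  obtain v where "v \<noteq> 0" "M *v v = 0"
    using assms by (metis invertible_left_inverse matrix_left_invertible_ker)
  then have "eigenvalue M (complex_of_real 0)"
    by (intro real_eigenvector_imp_eigenvalue) auto
  then show ?thesis
    unfolding hurwitz_stable_def by force
qed

lemma stable_symmetric_imp_negative_definite:
  fixes M :: "real ^ 'n ^ 'n"
  assumes "transpose M = M" "hurwitz_stable M" "w \<noteq> 0"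
  shows "w \<bullet> (M *v w) < 0"
proof -
  obtain m v where v: "v \<noteq> 0" "M *v v = m *\<^sub>R (mat 1 *v v)"
    and bound: "\<And>w. w \<bullet> (M *v w) \<le> m * (w \<bullet> (mat 1 *v w))"
    by (rule generalised_rayleigh_maximum[OF assms(1), of "mat 1"]) auto
  have "eigenvalue M (complex_of_real m)"
    using v by (intro real_eigenvector_imp_eigenvalue) auto
  then have "m < 0"
    using assms(2) by (auto simp: hurwitz_stable_def)
  then have "m * (w \<bullet> w) < 0"
    using assms(3) by (simp add: mult_neg_pos)
  then show ?thesis
    using bound[of w] by simp
qed

text \<open>For an eigenvector \<open>x + i y\<close> with eigenvalue \<open>z\<close>, adding the values of the form at \<open>x\<close> and
  at \<open>y\<close> cancels the contributions of \<open>Im z\<close> and leaves \<open>Re z\<close> times \<open>x \<bullet> x + y \<bullet> y\<close>.\<close>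

lemma unstable_imp_nonnegative_direction:
  fixes M :: "real ^ 'n ^ 'n"
  assumes "\<not> hurwitz_stable M"
  obtains w where "w \<noteq> 0" "w \<bullet> (M *v w) \<ge> 0"
proof -
  obtain z v where "Re z \<ge> 0" "v \<noteq> 0" and eq: "map_matrix complex_of_real M *v v = z *s v"
    using assms by (auto simp: hurwitz_stable_def eigenvalue_def not_less)
  define x y where "x = (\<chi> i. Re (v $ i))" and "y = (\<chi> i. Im (v $ i))"
  have comp: "(\<Sum>j\<in>UNIV. complex_of_real (M $ i $ j) * v $ j) = z * v $ i" for i
    using eq by (simp add: vec_eq_iff matrix_vector_mult_def map_matrix_def)
  have "M *v x = Re z *\<^sub>R x - Im z *\<^sub>R y"
    using arg_cong[OF comp, of Re]
    by (simp add: vec_eq_iff matrix_vector_mult_def x_def y_def)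
  moreover have "M *v y = Im z *\<^sub>R x + Re z *\<^sub>R y"
    using arg_cong[OF comp, of Im]
    by (simp add: vec_eq_iff matrix_vector_mult_def x_def y_def)
  ultimately have "x \<bullet> (M *v x) + y \<bullet> (M *v y) = Re z * (x \<bullet> x + y \<bullet> y)"
    by (simp add: inner_diff_right inner_add_right inner_commute[of y x] distrib_left)
  then have sum_nonneg: "x \<bullet> (M *v x) + y \<bullet> (M *v y) \<ge> 0"
    using \<open>Re z \<ge> 0\<close> by simp
  have "x \<noteq> 0 \<or> y \<noteq> 0"
    using \<open>v \<noteq> 0\<close> by (auto simp: x_def y_def vec_eq_iff complex_eq_iff)
  then show thesis
    using that[of x] that[of y] sum_nonneg by fastforce
qed

section \<open>Singular matrices on a segment\<close>

lemma segment_from_stable_to_unstable_meets_singular: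
  fixes M B :: "real ^ 'n ^ 'n"
  assumes symM: "transpose M = M" and symB: "transpose B = B"
    and stable: "hurwitz_stable M" and unstable: "\<not> hurwitz_stable (M + B)"
  obtains t where "0 \<le> t" "t \<le> 1" "\<not> invertible (M + t *\<^sub>R B)"
proof -
  have neg: "(- M) *v w = - (M *v w)" for w
    using matrix_vector_mult_diff_rdistrib[of 0 M w] by simp
  have posP: "w \<bullet> ((- M) *v w) > 0" if "w \<noteq> 0" for w
    using stable_symmetric_imp_negative_definite[OF symM stable that] by (simp add: neg)
  have "transpose (- M) = - M"
    using symM by (simp add: transpose_def vec_eq_iff)
  then obtain m v where v: "v \<noteq> 0" "B *v v = m *\<^sub>R ((- M) *v v)"
    and bound: "\<And>w. w \<bullet> (B *v w) \<le> m * (w \<bullet> ((- M) *v w))"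
    using generalised_rayleigh_maximum[OF symB _ posP] by metis
  obtain w where w: "w \<noteq> 0" "w \<bullet> ((M + B) *v w) \<ge> 0"
    using unstable_imp_nonnegative_direction[OF unstable] .
  then have "w \<bullet> ((- M) *v w) \<le> w \<bullet> (B *v w)"
    by (simp add: neg matrix_vector_mult_add_rdistrib inner_add_right)
  then have "1 * (w \<bullet> ((- M) *v w)) \<le> m * (w \<bullet> ((- M) *v w))"
    using bound[of w] by linarith
  then have "1 \<le> m"
    using posP[OF w(1)] mult_le_cancel_right_pos by blast
  have "(M + (1 / m) *\<^sub>R B) *v v = 0"
    using v(2) \<open>1 \<le> m\<close>
    by (simp add: matrix_vector_mult_add_rdistrib scaleR_matrix_vector_assoc[symmetric] neg)
  then have "\<not> invertible (M + (1 / m) *\<^sub>R B)"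
    using v(1) by (metis invertible_left_inverse matrix_left_invertible_ker)
  then show thesis
    using that[of "1 / m"] \<open>1 \<le> m\<close> by simp
qed

section \<open>Parametric matrices\<close>

lemma par_matrix_scale:
  "par_matrix K A (\<lambda>k. t * p k) = A 0 + t *\<^sub>R (\<Sum>k = 1..K. p k *\<^sub>R A k)"
  by (simp add: par_matrix_def scaleR_sum_right)

lemma par_matrix_cong:
  assumes "\<And>k. k \<in> {1..K} \<Longrightarrow> p k = q k"
  shows "par_matrix K A p = par_matrix K A q"
  using assms by (simp add: par_matrix_def)

lemma par_matrix_zero: "par_matrix K A (\<lambda>k. 0) = A 0"
  by (simp add: par_matrix_def)

lemma transpose_add: "transpose (M + N) = transpose M + transpose N"
  by (simp add: transpose_def vec_eq_iff)

lemma transpose_weighted_sum: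
  fixes A :: "nat \<Rightarrow> real ^ 'n ^ 'm"
  shows "transpose (\<Sum>k\<in>I. p k *\<^sub>R A k) = (\<Sum>k\<in>I. p k *\<^sub>R transpose (A k))"
  by (simp add: transpose_def vec_eq_iff)

text \<open>Symmetry on the unit box is a statement about coefficients: evaluate at the origin and at
  the unit vectors.\<close>

lemma symmetric_coefficients:
  fixes A :: "nat \<Rightarrow> real ^ 'n ^ 'n"
  assumes symmetric: "\<And>p. (\<forall>k\<in>{1..K}. \<bar>p k\<bar> \<le> 1) \<Longrightarrow>
      transpose (par_matrix K A p) = par_matrix K A p"
    and "k \<le> K"
  shows "transpose (A k) = A k"
proof -
  have zero: "transpose (A 0) = A 0"
    using symmetric[of "\<lambda>k. 0"] by (simp add: par_matrix_zero)
  show ?thesis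
  proof (cases "k = 0")
    case False
    then have "(\<Sum>j = 1..K. (if j = k then 1 else 0) *\<^sub>R A j) = A k"
      using \<open>k \<le> K\<close> by (simp add: if_distrib[of "\<lambda>c. c *\<^sub>R _"] cong: if_cong)
    then have "par_matrix K A (\<lambda>j. if j = k then 1 else 0) = A 0 + A k"
      by (simp add: par_matrix_def)
    then show ?thesis
      using symmetric[of "\<lambda>j. if j = k then 1 else 0"] zero by (simp add: transpose_add)
  qed (simp add: zero)
qed

theorem proposition6p1:
  fixes K :: nat
    and A :: "nat \<Rightarrow> real ^ 'n ^ 'n"
    and lo hi :: "nat \<Rightarrow> real"
  assumes normalised: "\<And>k. k \<in> {1..K} \<Longrightarrow> lo k = -1 \<and> hi k = 1"
    and symmetric: "\<And>p. p \<in> param_box K lo hi \<Longrightarrow> transpose (par_matrix K A p) = par_matrix K A p"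
    and stable_mid: "hurwitz_stable (par_matrix K A (param_mid lo hi))"
  shows "stability_radius K A lo hi = regularity_radius K A lo hi"
proof -
  have box: "p \<in> param_box K lo hi \<longleftrightarrow> (\<forall>k\<in>{1..K}. \<bar>p k\<bar> \<le> 1)" for p
    using normalised by (auto simp: param_box_def abs_le_iff)
  have mid: "param_mid lo hi k = 0" and rad: "param_rad lo hi k = 1" if "k \<in> {1..K}" for k
    using normalised[OF that] by (simp_all add: param_mid_def param_rad_def)
  have near: "(\<forall>k\<in>{1..K}. \<bar>p k - param_mid lo hi k\<bar> \<le> r * param_rad lo hi k)
      \<longleftrightarrow> (\<forall>k\<in>{1..K}. \<bar>p k\<bar> \<le> r)" for p r
    by (simp add: mid rad)
  have "par_matrix K A (param_mid lo hi) = A 0"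
    using par_matrix_cong[of K "param_mid lo hi" "\<lambda>k. 0" A] mid par_matrix_zero[of K A] by simp
  then have stable: "hurwitz_stable (A 0)"
    using stable_mid by simp
  have symA: "transpose (A k) = A k" if "k \<le> K" for k
    using symmetric_coefficients[OF symmetric[unfolded box] that] .
  have "(\<exists>p. (\<forall>k\<in>{1..K}. \<bar>p k\<bar> \<le> r) \<and> \<not> hurwitz_stable (par_matrix K A p)) \<longleftrightarrow>
      (\<exists>p. (\<forall>k\<in>{1..K}. \<bar>p k\<bar> \<le> 1) \<and> \<not> invertible (par_matrix K A (\<lambda>k. r * p k)))"
    (is "?unstable \<longleftrightarrow> ?singular") if "0 \<le> r" for r
  proof
    assume ?singular
    then obtain p where "\<forall>k\<in>{1..K}. \<bar>p k\<bar> \<le> 1" "\<not> invertible (par_matrix K A (\<lambda>k. r * p k))"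
      by blast
    then show ?unstable
      using \<open>0 \<le> r\<close> singular_imp_unstable
      by (intro exI[of _ "\<lambda>k. r * p k"]) (auto simp: abs_mult mult_left_le)
  next
    assume ?unstable
    then obtain p where p: "\<forall>k\<in>{1..K}. \<bar>p k\<bar> \<le> r" and "\<not> hurwitz_stable (par_matrix K A p)"
      by blast
    let ?B = "\<Sum>k = 1..K. p k *\<^sub>R A k"
    have "transpose ?B = ?B"
      by (simp add: transpose_weighted_sum symA)
    then obtain t where t: "0 \<le> t" "t \<le> 1" "\<not> invertible (A 0 + t *\<^sub>R ?B)"
      using segment_from_stable_to_unstable_meets_singular[of "A 0" ?B] symA[of 0] stable
        \<open>\<not> hurwitz_stable (par_matrix K A p)\<close>
      by (auto simp: par_matrix_def)
    \<comment> \<open>For \<open>r = 0\<close> the division gives \<open>q = 0\<close>, which is right, as \<open>p\<close> then vanishes on \<open>{1..K}\<close>.\<close>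
    define q where "q k = t * p k / r" for k
    have "\<bar>q k\<bar> \<le> 1" if "k \<in> {1..K}" for k
    proof -
      have "t * \<bar>p k\<bar> \<le> 1 * r"
        using t p that by (intro mult_mono) auto
      then show ?thesis
        using t \<open>0 \<le> r\<close> by (simp add: q_def abs_mult divide_le_eq_1 less_le)
    qed
    moreover have "par_matrix K A (\<lambda>k. r * q k) = A 0 + t *\<^sub>R ?B"
      using p by (subst par_matrix_scale[symmetric], intro par_matrix_cong) (auto simp: q_def)
    ultimately show ?singular
      using t(3) by (intro exI[of _ q]) auto
  qed
  then have "{r. 0 \<le> r \<and> (\<exists>p. (\<forall>k\<in>{1..K}. \<bar>p k\<bar> \<le> r) \<and> \<not> hurwitz_stable (par_matrix K A p))} =
      {r. 0 \<le> r \<and> (\<exists>p \<in> param_box K lo hi. \<not> invertible (par_matrix K A (\<lambda>k. r * p k)))}"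
    unfolding Bex_def box by blast
  then show ?thesis
    unfolding stability_radius_def regularity_radius_def near by simp
qed

end
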